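(* Every multiple unicast instance $\langle G,\{s_i-t_i\}_1^3\rangle$ with three unit-entropy sessions and connectivity level $[1~3~3]$ is feasible.
   Context: A network is a finite directed acyclic graph $G=(V,E)$ (parallel edges allowed) in which every edge has unit capacity. A multiple unicast instance $\langle G,\{s_i-t_i\}_1^n\rangle$ consists of $G$ together with source nodes $s_i$ (having no incoming edges) and terminal nodes $t_i$ (having no outgoing edges). Each source $s_i$ observes a unit-entropy message to be communicated to $t_i$; messages are independent. The connectivity level is the vector $[k_1~\dots~k_n]$ where $k_i$ is the maximum flow from $s_i$ to $t_i$ in $G$. Linear network codes: for a finite field $\mathbb{F}_q$ (with $q$ free to be chosen) and vector length $T\ge 1$, each unit-entropy message is a vector in $\mathbb{F}_q^T$; each edge carries a vector in $\mathbb{F}_q^T$ that is an $\mathbb{F}_q$-linear function of the vectors carried on the incoming edges of its tail and of the messages observed at its tail. The code is a solution if every terminal $t_i$ can recover the message of $s_i$ (for all message values) from the vectors on its incoming edges. The case $T=1$ is called scalar, general $T$ is called vector linear network coding. The instance is feasible if it has a (scalar or vector) linear network coding solution for some $q$ and $T$. *)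

theory Defs
  imports Complex_Main "HOL-Algebra.Module" "Graph_Theory.Digraph"
begin

section \<open>Networks and maximum flow\<close>

text \<open>Arcs of a \<^typ>\<open>('v, 'e) pre_digraph\<close> have their own identity, so parallel edges are allowed.\<close>

locale network = fin_digraph G for G :: "('v, 'e) pre_digraph" +
  assumes acyclic_arcs: "acyclic (arcs_ends G)"

definition is_flow :: "('v, 'e) pre_digraph \<Rightarrow> 'v \<Rightarrow> 'v \<Rightarrow> ('e \<Rightarrow> real) \<Rightarrow> bool" where
  "is_flow G s t f \<longleftrightarrow>
     (\<forall>e \<in> arcs G. 0 \<le> f e \<and> f e \<le> 1) \<and>
     (\<forall>v \<in> verts G - {s, t}. (\<Sum>e \<in> in_arcs G v. f e) = (\<Sum>e \<in> out_arcs G v. f e))"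

definition flow_value :: "('v, 'e) pre_digraph \<Rightarrow> 'v \<Rightarrow> ('e \<Rightarrow> real) \<Rightarrow> real" where
  "flow_value G s f = (\<Sum>e \<in> out_arcs G s. f e) - (\<Sum>e \<in> in_arcs G s. f e)"

text \<open>In a finite graph the values are bounded by the number of arcs and the zero flow exists,
  so the supremum below is never one of an empty or unbounded set.\<close>

definition max_flow :: "('v, 'e) pre_digraph \<Rightarrow> 'v \<Rightarrow> 'v \<Rightarrow> real" where
  "max_flow G s t = Sup {flow_value G s f | f. is_flow G s t f}"

section \<open>Multiple unicast instances\<close>

text \<open>Sessions are numbered \<open>1, \<dots>, n\<close>; values of \<open>s\<close> and \<open>t\<close> elsewhere are irrelevant.
  Different sessions may share a source or a terminal node.\<close>

locale multiple_unicast = network G for G :: "('v, 'e) pre_digraph" +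
  fixes n :: nat and s t :: "nat \<Rightarrow> 'v"
  assumes source_in_verts: "i \<in> {1..n} \<Longrightarrow> s i \<in> verts G"
    and terminal_in_verts: "i \<in> {1..n} \<Longrightarrow> t i \<in> verts G"
    and source_no_in_arcs: "i \<in> {1..n} \<Longrightarrow> in_arcs G (s i) = {}"
    and terminal_no_out_arcs: "i \<in> {1..n} \<Longrightarrow> out_arcs G (t i) = {}"

definition connectivity_level ::
    "('v, 'e) pre_digraph \<Rightarrow> nat \<Rightarrow> (nat \<Rightarrow> 'v) \<Rightarrow> (nat \<Rightarrow> 'v) \<Rightarrow> real list" where
  "connectivity_level G n s t = map (\<lambda>i. max_flow G (s i) (t i)) [1..<n + 1]"

section \<open>Linear network codes\<close>

text \<open>The space \<open>F\<^sup>I\<close>. The fields \<open>mult\<close> and \<open>one\<close> of the record play no role for modules.\<close>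

definition coord_space :: "('c, 'm) ring_scheme \<Rightarrow> 'i set \<Rightarrow> ('c, 'i \<Rightarrow> 'c) module" where
  "coord_space F I =
     \<lparr>carrier = I \<rightarrow>\<^sub>E carrier F,
      mult = (\<lambda>x y. \<lambda>i\<in>I. x i \<otimes>\<^bsub>F\<^esub> y i),
      one = (\<lambda>i\<in>I. \<one>\<^bsub>F\<^esub>),
      zero = (\<lambda>i\<in>I. \<zero>\<^bsub>F\<^esub>),
      add = (\<lambda>x y. \<lambda>i\<in>I. x i \<oplus>\<^bsub>F\<^esub> y i),
      smult = (\<lambda>a x. \<lambda>i\<in>I. a \<otimes>\<^bsub>F\<^esub> x i)\<rparr>"

lemma module_coord_space:
  assumes "cring F"
  shows "Module.module F (coord_space F I)"
proof -
  interpret F: cring F by fact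
  show ?thesis
  proof (rule Module.moduleI)
    show "abelian_group (coord_space F I)"
    proof (rule abelian_groupI)
      fix x assume x: "x \<in> carrier (coord_space F I)"
      then have "(\<lambda>i\<in>I. \<ominus>\<^bsub>F\<^esub> x i) \<in> carrier (coord_space F I)"
        and "(\<lambda>i\<in>I. \<ominus>\<^bsub>F\<^esub> x i) \<oplus>\<^bsub>coord_space F I\<^esub> x = \<zero>\<^bsub>coord_space F I\<^esub>"
        by (auto simp: coord_space_def PiE_iff F.l_neg intro!: restrict_ext)
      then show "\<exists>y\<in>carrier (coord_space F I). y \<oplus>\<^bsub>coord_space F I\<^esub> x = \<zero>\<^bsub>coord_space F I\<^esub>"
        by blast
    qed (auto simp: coord_space_def PiE_iff extensional_def F.a_ac restrict_def
        intro!: ext)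
  qed (auto simp: coord_space_def PiE_iff extensional_def restrict_def
      F.l_distr F.r_distr F.m_assoc assms intro!: ext)
qed

definition linear_maps ::
    "('c, 'm) ring_scheme \<Rightarrow> ('c, 'a) module \<Rightarrow> ('c, 'b) module \<Rightarrow> ('a \<Rightarrow> 'b) set" where
  "linear_maps F M N =
     {h \<in> hom (add_monoid M) (add_monoid N).
        \<forall>a \<in> carrier F. \<forall>x \<in> carrier M. h (a \<odot>\<^bsub>M\<^esub> x) = a \<odot>\<^bsub>N\<^esub> h x}"

definition messages :: "('c, 'm) ring_scheme \<Rightarrow> nat \<Rightarrow> nat \<Rightarrow> (nat \<Rightarrow> nat \<Rightarrow> 'c) set" where
  "messages F T n = {1..n} \<rightarrow>\<^sub>E carrier (coord_space F {..<T})"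

text \<open>What is available at node \<open>v\<close>: one vector per incoming arc (\<open>Inl\<close>) and one per message
  observed at \<open>v\<close> (\<open>Inr\<close>). A family of vectors of \<open>F\<^sup>T\<close> indexed by \<open>J\<close> is an element of
  \<open>F\<^sup>I\<close> with \<open>I = J \<times> {..<T}\<close>.\<close>

definition input_index :: "('v, 'e) pre_digraph \<Rightarrow> nat \<Rightarrow> (nat \<Rightarrow> 'v) \<Rightarrow> 'v \<Rightarrow> ('e + nat) set" where
  "input_index G n s v = in_arcs G v <+> {i \<in> {1..n}. s i = v}"

definition node_input ::
    "('v, 'e) pre_digraph \<Rightarrow> nat \<Rightarrow> (nat \<Rightarrow> 'v) \<Rightarrow> nat \<Rightarrow> 'v \<Rightarrow>
     (nat \<Rightarrow> nat \<Rightarrow> 'c) \<Rightarrow> ('e \<Rightarrow> nat \<Rightarrow> 'c) \<Rightarrow> ('e + nat) \<times> nat \<Rightarrow> 'c" where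
  "node_input G n s T v x y =
     (\<lambda>(j, k) \<in> input_index G n s v \<times> {..<T}. case j of Inl e \<Rightarrow> y e k | Inr i \<Rightarrow> x i k)"

text \<open>\<open>y x e\<close> is the vector carried on arc \<open>e\<close> when the messages are \<open>x\<close>.\<close>

definition linear_network_code ::
    "('c, 'm) ring_scheme \<Rightarrow> nat \<Rightarrow> ('v, 'e) pre_digraph \<Rightarrow> nat \<Rightarrow> (nat \<Rightarrow> 'v) \<Rightarrow>
     ((nat \<Rightarrow> nat \<Rightarrow> 'c) \<Rightarrow> 'e \<Rightarrow> nat \<Rightarrow> 'c) \<Rightarrow> bool" where
  "linear_network_code F T G n s y \<longleftrightarrow>
     (\<forall>e \<in> arcs G.
        \<exists>L \<in> linear_maps F (coord_space F (input_index G n s (tail G e) \<times> {..<T}))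
                           (coord_space F {..<T}).
          \<forall>x \<in> messages F T n. y x e = L (node_input G n s T (tail G e) x (y x)))"

definition recovers_messages ::
    "('c, 'm) ring_scheme \<Rightarrow> nat \<Rightarrow> ('v, 'e) pre_digraph \<Rightarrow> nat \<Rightarrow> (nat \<Rightarrow> 'v) \<Rightarrow>
     ((nat \<Rightarrow> nat \<Rightarrow> 'c) \<Rightarrow> 'e \<Rightarrow> nat \<Rightarrow> 'c) \<Rightarrow> bool" where
  "recovers_messages F T G n t y \<longleftrightarrow>
     (\<forall>i \<in> {1..n}. \<exists>dec. \<forall>x \<in> messages F T n. dec (restrict (y x) (in_arcs G (t i))) = x i)"

text \<open>Every finite field has an isomorphic copy whose carrier is a set of natural numbers, so
  quantifying over \<^typ>\<open>nat ring\<close> covers all finite fields.\<close>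

definition feasible :: "('v, 'e) pre_digraph \<Rightarrow> nat \<Rightarrow> (nat \<Rightarrow> 'v) \<Rightarrow> (nat \<Rightarrow> 'v) \<Rightarrow> bool" where
  "feasible G n s t \<longleftrightarrow>
     (\<exists>(F :: nat ring) T y. field F \<and> finite (carrier F) \<and> T \<ge> 1 \<and>
        linear_network_code F T G n s y \<and> recovers_messages F T G n t y)"

end

(* Time-sharing with vectors of length 2 over GF(2): slot k carries symbol k of session 1
   together with both symbols of session k + 2. So it suffices that two unicast sessions with
   connectivity 1 and 3 support the rates 1 and 2.

   For this take a path P from s1 to t1 and three arc-disjoint chains Q from s2 to t2. A chain
   forwards its symbol until it first meets P, where P and the chain both continue with the sum;
   whenever P later meets a chain that it has met before, P continues with the symbol of the
   chain. Then t1 receives X + u . z, where X is the message of s1 and z the vector of three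
   symbols on the chains, and s2 chooses z in a two-dimensional subspace of the kernel of u.
   If P and Q meet, t2 also sees X + u . z = X and can undo the sums. *)
theory Submission
  imports Defs "Graph_Theory.Arc_Walk"
begin

section \<open>Cuts and minimal connected arc sets\<close>

text \<open>A chain that has met \<open>P\<close> already contains \<open>X\<close>, so adding the
  symbol of \<open>P\<close> a second time would cancel \<open>X\<close> modulo 2. Continuing with
  the chain instead keeps the coefficient of \<open>X\<close> equal to 1 on \<open>P\<close> and on
  all met chains, and the symbol of \<open>P\<close> stays readable on some chain up to
  \<open>t2\<close>. Disjoint \<open>P\<close> and \<open>Q\<close> are harmless, because then
  \<open>X\<close> never enters \<open>Q\<close>.

  The other obstacle is to get chains out of a supremum over real flows. Only weak duality is used:
  every cut has at least three arcs. An arc set minimal with this property is balanced at inner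
  nodes by submodularity of cuts, and matching incoming with outgoing arcs there links it into
  chains, so neither an optimal nor an integral flow has to be constructed.\<close>

definition leaving :: "('v, 'e) pre_digraph \<Rightarrow> 'e set \<Rightarrow> 'v set \<Rightarrow> 'e set" where
  "leaving G A S = {e \<in> A. tail G e \<in> S \<and> head G e \<notin> S}"

lemma finite_leaving [simp]: "finite A \<Longrightarrow> finite (leaving G A S)"
  by (simp add: leaving_def)

section \<open>Weak duality between flows and cuts\<close>

lemma (in fin_digraph) sum_over_arcs_by_end:
  fixes f :: "'b \<Rightarrow> real"
  assumes "finite S"
  shows "(\<Sum>v\<in>S. sum f (out_arcs G v)) = sum f {e \<in> arcs G. tail G e \<in> S}"
    and "(\<Sum>v\<in>S. sum f (in_arcs G v)) = sum f {e \<in> arcs G. head G e \<in> S}"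
proof -
  have "(\<Sum>v\<in>S. sum f (out_arcs G v)) = sum f (\<Union>v\<in>S. out_arcs G v)"
    by (rule sum.UNION_disjoint[symmetric]) (use assms in auto)
  also have "(\<Union>v\<in>S. out_arcs G v) = {e \<in> arcs G. tail G e \<in> S}"
    by auto
  finally show "(\<Sum>v\<in>S. sum f (out_arcs G v)) = sum f {e \<in> arcs G. tail G e \<in> S}" .
  have "(\<Sum>v\<in>S. sum f (in_arcs G v)) = sum f (\<Union>v\<in>S. in_arcs G v)"
    by (rule sum.UNION_disjoint[symmetric]) (use assms in auto)
  also have "(\<Union>v\<in>S. in_arcs G v) = {e \<in> arcs G. head G e \<in> S}"
    by auto
  finally show "(\<Sum>v\<in>S. sum f (in_arcs G v)) = sum f {e \<in> arcs G. head G e \<in> S}" .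
qed

text \<open>Summing conservation over \<open>S\<close> leaves the net value at \<open>s\<close>.
  Arcs inside \<open>S\<close> cancel, entering arcs only lower the total, and each leaving arc
  carries at most 1.\<close>

lemma (in fin_digraph) flow_value_le_cut:
  assumes f: "is_flow G s t f" and S: "S \<subseteq> verts G" "s \<in> S" "t \<notin> S"
  shows "flow_value G s f \<le> card (leaving G (arcs G) S)"
proof -
  have fin: "finite S"
    using finite_subset[OF S(1)] by simp
  define I where "I = {e \<in> arcs G. tail G e \<in> S \<and> head G e \<in> S}"
  define R where "R = {e \<in> arcs G. tail G e \<notin> S \<and> head G e \<in> S}"
  have nonneg: "0 \<le> sum f R"
    using f by (auto simp: is_flow_def R_def intro!: sum_nonneg)
  have "(\<Sum>v\<in>S. sum f (out_arcs G v) - sum f (in_arcs G v)) = (\<Sum>v\<in>S. if v = s then flow_value G s f else 0)"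
  proof (rule sum.cong)
    fix v assume "v \<in> S"
    show "sum f (out_arcs G v) - sum f (in_arcs G v) = (if v = s then flow_value G s f else 0)"
    proof (cases "v = s")
      case False
      then have "v \<in> verts G - {s, t}" using \<open>v \<in> S\<close> S by auto
      then show ?thesis using f False unfolding is_flow_def by simp
    qed (simp add: flow_value_def)
  qed simp
  then have "flow_value G s f = (\<Sum>v\<in>S. sum f (out_arcs G v)) - (\<Sum>v\<in>S. sum f (in_arcs G v))"
    using S fin by (simp add: sum_subtractf)
  also have "\<dots> = sum f {e \<in> arcs G. tail G e \<in> S} - sum f {e \<in> arcs G. head G e \<in> S}"
    using fin by (simp add: sum_over_arcs_by_end)
  also have "{e \<in> arcs G. tail G e \<in> S} = leaving G (arcs G) S \<union> I"
    by (auto simp: leaving_def I_def)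
  also have "{e \<in> arcs G. head G e \<in> S} = R \<union> I"
    by (auto simp: R_def I_def)
  also have "sum f (leaving G (arcs G) S \<union> I) = sum f (leaving G (arcs G) S) + sum f I"
    by (rule sum.union_disjoint) (auto simp: leaving_def I_def)
  also have "sum f (R \<union> I) = sum f R + sum f I"
    by (rule sum.union_disjoint) (auto simp: R_def I_def)
  finally have "flow_value G s f \<le> sum f (leaving G (arcs G) S)"
    using nonneg by simp
  also have "\<dots> \<le> (\<Sum>e\<in>leaving G (arcs G) S. 1)"
    using f by (intro sum_mono) (auto simp: is_flow_def leaving_def)
  finally show ?thesis
    by simp
qed

lemma zero_is_flow: "is_flow G s t (\<lambda>_. 0)"
  by (simp add: is_flow_def)

lemma (in fin_digraph) max_flow_le_cut:
  assumes "S \<subseteq> verts G" "s \<in> S" "t \<notin> S"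
  shows "max_flow G s t \<le> card (leaving G (arcs G) S)"
  unfolding max_flow_def
proof (rule cSup_least)
  show "{flow_value G s f |f. is_flow G s t f} \<noteq> {}"
    using zero_is_flow[of G s t] by auto
next
  fix x assume "x \<in> {flow_value G s f |f. is_flow G s t f}"
  then obtain f where "is_flow G s t f" "x = flow_value G s f"
    by blast
  then show "x \<le> card (leaving G (arcs G) S)"
    using flow_value_le_cut[OF _ assms] by simp
qed

text \<open>Used to exclude coinciding source and terminal, where no cut separates the ends and the
  cut bound says nothing.\<close>

lemma max_flow_isolated:
  assumes "in_arcs G s = {}" "out_arcs G s = {}"
  shows "max_flow G s t = 0"
proof -
  have "{flow_value G s f |f. is_flow G s t f} = {0}"
    using assms zero_is_flow[of G s t] by (auto simp: flow_value_def)
  then show ?thesis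
    by (simp add: max_flow_def)
qed

text \<open>The cut side of Menger's theorem, relative to an arc set \<open>A\<close> so that arcs
  can be deleted while the cuts stay the same.\<close>

definition cut_connected :: "('v, 'e) pre_digraph \<Rightarrow> 'v \<Rightarrow> 'v \<Rightarrow> nat \<Rightarrow> 'e set \<Rightarrow> bool" where
  "cut_connected G s t k A \<longleftrightarrow>
     (\<forall>S \<subseteq> verts G. s \<in> S \<longrightarrow> t \<notin> S \<longrightarrow> k \<le> card (leaving G A S))"

lemma (in fin_digraph) max_flow_imp_cut_connected:
  "real k \<le> max_flow G s t \<Longrightarrow> cut_connected G s t k (arcs G)"
  unfolding cut_connected_def
proof (intro allI impI)
  fix S assume "real k \<le> max_flow G s t" "S \<subseteq> verts G" "s \<in> S" "t \<notin> S"
  then have "real k \<le> real (card (leaving G (arcs G) S))"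
    using max_flow_le_cut[of S s t] by linarith
  then show "k \<le> card (leaving G (arcs G) S)"
    by simp
qed

text \<open>An arc leaving the intersection or the union leaves \<open>S\<close> or
  \<open>S'\<close>, and an arc leaving both of them leaves \<open>S\<close> and
  \<open>S'\<close>.\<close>

lemma card_leaving_submodular:
  assumes "finite A"
  shows "card (leaving G A (S \<inter> S')) + card (leaving G A (S \<union> S'))
    \<le> card (leaving G A S) + card (leaving G A S')"
proof -
  let ?L = "leaving G A"
  have "card (?L (S \<inter> S')) + card (?L (S \<union> S')) =
      card (?L (S \<inter> S') \<union> ?L (S \<union> S')) + card (?L (S \<inter> S') \<inter> ?L (S \<union> S'))"
    using assms by (intro card_Un_Int) auto
  also have "\<dots> \<le> card (?L S \<union> ?L S') + card (?L S \<inter> ?L S')"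
    by (intro add_mono card_mono) (use assms in \<open>auto simp: leaving_def\<close>)
  also have "\<dots> = card (?L S) + card (?L S')"
    using assms by (intro card_Un_Int[symmetric]) auto
  finally show ?thesis .
qed

section \<open>Uncrossing tight cuts of a minimal arc set\<close>

locale minimal_cut_connected =
  fixes G :: "('v, 'e) pre_digraph" and s t k A
  assumes fin: "finite A"
    and conn: "cut_connected G s t k A"
    and minimal: "e \<in> A \<Longrightarrow> \<not> cut_connected G s t k (A - {e})"
begin

definition tight :: "'v set \<Rightarrow> bool" where
  "tight S \<longleftrightarrow> S \<subseteq> verts G \<and> s \<in> S \<and> t \<notin> S \<and> card (leaving G A S) = k"

lemma card_leaving_ge:
  "S \<subseteq> verts G \<Longrightarrow> s \<in> S \<Longrightarrow> t \<notin> S \<Longrightarrow> k \<le> card (leaving G A S)"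
  using conn by (simp add: cut_connected_def)

text \<open>Both new cuts have at least \<open>k\<close> arcs, and by submodularity at most
  \<open>2 * k\<close> together.\<close>

lemma tight_Int_Un:
  assumes "tight S" "tight S'"
  shows "tight (S \<inter> S')" "tight (S \<union> S')"
proof -
  have "k \<le> card (leaving G A (S \<inter> S'))" "k \<le> card (leaving G A (S \<union> S'))"
    by (rule card_leaving_ge; use assms in \<open>auto simp: tight_def\<close>)+
  moreover have "card (leaving G A S) = k" "card (leaving G A S') = k"
    using assms by (auto simp: tight_def)
  ultimately have "card (leaving G A (S \<inter> S')) = k" "card (leaving G A (S \<union> S')) = k"
    using card_leaving_submodular[OF fin, of G S S'] by linarith+
  with assms show "tight (S \<inter> S')" "tight (S \<union> S')"
    by (auto simp: tight_def)
qed

text \<open>Deleting \<open>e\<close> pushes some cut below \<open>k\<close>. That cut loses at most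
  one arc, so it contains \<open>e\<close> and had exactly \<open>k\<close> arcs.\<close>

lemma tight_cut_of_arc:
  assumes "e \<in> A"
  obtains S where "tight S" "tail G e \<in> S" "head G e \<notin> S"
proof -
  obtain S where S: "S \<subseteq> verts G" "s \<in> S" "t \<notin> S" and less: "card (leaving G (A - {e}) S) < k"
    using minimal[OF assms] by (auto simp: cut_connected_def not_le)
  have eq: "leaving G (A - {e}) S = leaving G A S - {e}"
    by (auto simp: leaving_def)
  have ge: "k \<le> card (leaving G A S)"
    using S by (rule card_leaving_ge)
  then have e: "e \<in> leaving G A S"
    using less eq by (metis Diff_empty Diff_insert0 not_le)
  then have "card (leaving G A S) = k"
    using less ge eq fin by simp
  with S e show ?thesis
    by (intro that[of S]) (auto simp: tight_def leaving_def)
qed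

text \<open>Intersecting the tight cuts of the single arcs keeps their common tail inside and puts
  every head outside. The dual lemma takes unions.\<close>

lemma tight_cut_of_out_arcs:
  assumes "finite B" "B \<noteq> {}" "B \<subseteq> A" "\<And>e. e \<in> B \<Longrightarrow> tail G e = v"
  shows "\<exists>S. tight S \<and> v \<in> S \<and> (\<forall>e\<in>B. head G e \<notin> S)"
  using assms
proof (induction B rule: finite_ne_induct)
  case (singleton e)
  then show ?case using tight_cut_of_arc[of e] by auto
next
  case (insert e B)
  obtain S where "tight S" "v \<in> S" "head G e \<notin> S"
    using tight_cut_of_arc[of e] insert.prems by auto
  moreover obtain S' where "tight S'" "v \<in> S'" "\<forall>e\<in>B. head G e \<notin> S'"
    using insert by auto
  ultimately show ?case
    using tight_Int_Un(1)[of S S'] by (intro exI[of _ "S \<inter> S'"]) auto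
qed

lemma tight_cut_of_in_arcs:
  assumes "finite B" "B \<noteq> {}" "B \<subseteq> A" "\<And>e. e \<in> B \<Longrightarrow> head G e = v"
  shows "\<exists>S. tight S \<and> v \<notin> S \<and> (\<forall>e\<in>B. tail G e \<in> S)"
  using assms
proof (induction B rule: finite_ne_induct)
  case (singleton e)
  then show ?case using tight_cut_of_arc[of e] by auto
next
  case (insert e B)
  obtain S where "tight S" "v \<notin> S" "tail G e \<in> S"
    using tight_cut_of_arc[of e] insert.prems by auto
  moreover obtain S' where "tight S'" "v \<notin> S'" "\<forall>e\<in>B. tail G e \<in> S'"
    using insert by auto
  ultimately show ?case
    using tight_Int_Un(2)[of S S'] by (intro exI[of _ "S \<union> S'"]) auto
qed

text \<open>Tight cuts are closed under intersection and union, so one tight cut \<open>S\<close> contains \<open>v\<close> and is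
  left by all arcs out of \<open>v\<close>; comparing it with \<open>S - {v}\<close> bounds the out-degree by the in-degree.
  The other inequality is dual.\<close>

lemma balanced:
  assumes v: "v \<in> verts G" "v \<noteq> s" "v \<noteq> t"
  shows "card {e \<in> A. head G e = v} = card {e \<in> A. tail G e = v}" (is "card ?I = card ?O")
proof (rule antisym)
  show "card ?O \<le> card ?I"
  proof (cases "?O = {}")
    case True
    then show ?thesis by (simp only: card.empty)
  next
    case False
    moreover have "finite ?O" "?O \<subseteq> A"
      using fin by auto
    ultimately obtain S where S: "tight S" "v \<in> S" and outc: "\<forall>e\<in>?O. head G e \<notin> S"
      using tight_cut_of_out_arcs[of ?O v] by blast
    have sub: "?O \<subseteq> leaving G A S"
      using S outc by (auto simp: leaving_def)
    have "k \<le> card (leaving G A (S - {v}))"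
      by (rule card_leaving_ge) (use S v in \<open>auto simp: tight_def\<close>)
    \<comment> \<open>Arcs out of \<open>v\<close> no longer count, and an arc that leaves only the
      smaller set has head \<open>v\<close>.\<close>
    also have "\<dots> \<le> card ((leaving G A S - ?O) \<union> ?I)"
      by (rule card_mono) (use fin in \<open>auto simp: leaving_def\<close>)
    also have "\<dots> \<le> card (leaving G A S - ?O) + card ?I"
      by (rule card_Un_le)
    also have "card (leaving G A S - ?O) = k - card ?O"
      using S sub fin by (simp add: card_Diff_subset tight_def)
    finally show ?thesis
      using card_mono[OF _ sub] fin S by (simp add: tight_def)
  qed
  show "card ?I \<le> card ?O"
  proof (cases "?I = {}")
    case True
    then show ?thesis by (simp only: card.empty)
  next
    case False
    moreover have "finite ?I" "?I \<subseteq> A"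
      using fin by auto
    ultimately obtain S where S: "tight S" "v \<notin> S" and inc: "\<forall>e\<in>?I. tail G e \<in> S"
      using tight_cut_of_in_arcs[of ?I v] by blast
    have sub: "?I \<subseteq> leaving G A S"
      using S inc by (auto simp: leaving_def)
    have "k \<le> card (leaving G A (insert v S))"
      by (rule card_leaving_ge) (use S v in \<open>auto simp: tight_def\<close>)
    also have "\<dots> \<le> card ((leaving G A S - ?I) \<union> ?O)"
      by (rule card_mono) (use fin in \<open>auto simp: leaving_def\<close>)
    also have "\<dots> \<le> card (leaving G A S - ?I) + card ?O"
      by (rule card_Un_le)
    also have "card (leaving G A S - ?I) = k - card ?I"
      using S sub fin by (simp add: card_Diff_subset tight_def)
    finally show ?thesis
      using card_mono[OF _ sub] fin S by (simp add: tight_def)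
  qed
qed

end

lemma exists_minimal_cut_connected:
  assumes "finite E" "cut_connected G s t k E"
  obtains A where "A \<subseteq> E" "minimal_cut_connected G s t k A"
proof -
  let ?P = "\<lambda>A. A \<subseteq> E \<and> cut_connected G s t k A"
  have "\<exists>A. ?P A \<and> (\<forall>B. ?P B \<longrightarrow> card A \<le> card B)"
    using assms(2) by (intro ex_has_least_nat[of ?P E card]) auto
  then obtain A where A: "?P A" and least: "\<And>B. ?P B \<Longrightarrow> card A \<le> card B"
    by blast
  have fin: "finite A"
    using A assms(1) by (meson finite_subset)
  show ?thesis
  proof (rule that[of A])
    show "minimal_cut_connected G s t k A"
    proof
      fix e assume "e \<in> A"
      then have "card (A - {e}) < card A"
        using fin by (rule card_Diff1_less[rotated])
      then show "\<not> cut_connected G s t k (A - {e})"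
        using least[of "A - {e}"] A by auto
    qed (use A fin in auto)
  qed (use A in auto)
qed

section \<open>Coding on a path crossing disjoint chains\<close>

lemma mod_2_add_right_cancel:
  fixes p p' q q' :: nat
  assumes "p mod 2 = p' mod 2" "(q + p) mod 2 = (q' + p') mod 2"
  shows "q mod 2 = q' mod 2"
proof -
  have "odd p \<longleftrightarrow> odd p'" "odd (q + p) \<longleftrightarrow> odd (q' + p')"
    using assms by (simp_all only: odd_iff_mod_2_eq_one)
  then show ?thesis
    by (auto simp: mod2_eq_if)
qed

text \<open>\<open>r\<close> is a topological rank. \<open>P\<close> is the arc set of a path with first arc \<open>a\<close> and predecessor
  map \<open>\<omega>\<close>; \<open>Q\<close> is a union of disjoint chains with first arcs \<open>S\<close> and predecessor map \<open>\<pi>\<close>.\<close>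

locale crossing_chains =
  fixes r :: "'e \<Rightarrow> nat" and P Q S :: "'e set" and a :: 'e and \<omega> \<pi> :: "'e \<Rightarrow> 'e"
  assumes inj_r: "inj_on r (P \<union> Q)"
    and a: "a \<in> P" "e \<in> P \<Longrightarrow> r a \<le> r e"
    and \<omega>: "e \<in> P - {a} \<Longrightarrow> \<omega> e \<in> P" "e \<in> P - {a} \<Longrightarrow> r (\<omega> e) < r e"
      "e \<in> P - {a} \<Longrightarrow> f \<in> P \<Longrightarrow> r f < r e \<Longrightarrow> r f \<le> r (\<omega> e)"
    and \<pi>: "e \<in> Q - S \<Longrightarrow> \<pi> e \<in> Q" "e \<in> Q - S \<Longrightarrow> r (\<pi> e) < r e" "inj_on \<pi> (Q - S)"
    and S: "S \<subseteq> Q" "finite S"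
begin

text \<open>For a chain arc: the chain has touched \<open>P\<close> at \<open>e\<close> or before.
  All arcs of \<open>P\<close> count as met, even outside \<open>Q\<close>, since their symbols
  contain \<open>X\<close>.\<close>

function met :: "'e \<Rightarrow> bool" where
  "met e \<longleftrightarrow> (if e \<in> P then True else if e \<in> Q - S then met (\<pi> e) else False)"
  by pat_completeness auto
termination by (relation "measure r") (simp_all only: in_measure wf_measure \<pi>(2))

declare met.simps [simp del]

text \<open>The symbol arriving along \<open>P\<close> is used at \<open>e\<close>: on
  \<open>P\<close> away from the chains and at the first meeting with a chain, but not where
  \<open>P\<close> switches to a chain met earlier.\<close>

definition joins :: "'e \<Rightarrow> bool" where
  "joins e \<longleftrightarrow> e \<in> P \<and> \<not> (e \<in> Q - S \<and> met (\<pi> e))"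

text \<open>Chain input plus path input, an absent input counting as 0. The message \<open>X\<close>
  plays the role of a predecessor of \<open>a\<close>, and \<open>z e\<close> that of a predecessor
  of a start \<open>e\<close>.\<close>

function val :: "nat \<Rightarrow> ('e \<Rightarrow> nat) \<Rightarrow> 'e \<Rightarrow> nat" where
  "val X z e =
    ((if e \<in> Q - S then val X z (\<pi> e) else if e \<in> S then z e else 0) +
     (if e = a then (if joins e then X else 0)
      else if e \<in> P - {a} then (if joins e then val X z (\<omega> e) else 0) else 0)) mod 2"
  by pat_completeness auto
termination
  by (relation "measure (\<lambda>(X, z, e). r e)") (simp_all only: in_measure wf_measure \<pi>(2) \<omega>(2) case_prod_conv)

declare val.simps [simp del]

lemma val_less_2 [simp]: "val X z e < 2"
  by (subst val.simps) simp

lemma val_copy_Q: "e \<in> Q - S \<Longrightarrow> \<not> joins e \<Longrightarrow> val X z e = val X z (\<pi> e)"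
  by (subst val.simps) auto

lemma val_copy_P: "e \<in> P - Q \<Longrightarrow> val X z e = (if e = a then X mod 2 else val X z (\<omega> e))"
  using S by (subst val.simps) (auto simp: joins_def)

lemma val_join:
  assumes "joins e" "e \<in> Q"
  shows "val X z e = ((if e \<in> S then z e else val X z (\<pi> e)) +
    (if e = a then X else val X z (\<omega> e))) mod 2"
  using assms by (subst val.simps) (auto simp: joins_def)

lemma r_neq: "e \<in> P \<union> Q \<Longrightarrow> f \<in> P \<union> Q \<Longrightarrow> f \<noteq> e \<Longrightarrow> r f \<noteq> r e"
  using inj_onD[OF inj_r] by metis

text \<open>The arcs on which the chains are waiting once all arcs of rank below \<open>k\<close> are processed.\<close>

definition frontier :: "nat \<Rightarrow> 'e set" where
  "frontier k = {c \<in> Q. r c < k \<and> (\<forall>f \<in> Q - S. \<pi> f = c \<longrightarrow> k \<le> r f)}"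

definition current :: "nat \<Rightarrow> 'e \<Rightarrow> bool" where
  "current k e \<longleftrightarrow> e \<in> P \<and> r e < k \<and> (\<forall>f \<in> P. r f < k \<longrightarrow> r f \<le> r e)"

lemma frontier_Suc:
  assumes "c \<in> frontier k" "\<And>f. f \<in> Q - S \<Longrightarrow> \<pi> f = c \<Longrightarrow> r f \<noteq> k"
  shows "c \<in> frontier (Suc k)"
proof -
  have "Suc k \<le> r f" if "f \<in> Q - S" "\<pi> f = c" for f
  proof -
    have "k \<le> r f" using assms(1) that by (simp add: frontier_def)
    then show ?thesis using assms(2)[OF that] by simp
  qed
  then show ?thesis using assms(1) by (simp add: frontier_def)
qed

lemma latest_in_frontier:
  assumes "c \<in> Q"
  shows "c \<in> frontier (Suc (r c))"
proof -
  have "Suc (r c) \<le> r f" if "f \<in> Q - S" "\<pi> f = c" for f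
    using \<pi>(2)[OF that(1)] that(2) by simp
  then show ?thesis using assms by (simp add: frontier_def)
qed

lemma Suc_le_r:
  assumes "\<forall>f \<in> A. k \<le> r f" "\<And>f. f \<in> A \<Longrightarrow> r f \<noteq> k"
  shows "\<forall>f \<in> A. Suc k \<le> r f"
proof
  fix f assume "f \<in> A"
  then have "k \<le> r f" "r f \<noteq> k" using assms by auto
  then show "Suc k \<le> r f" by simp
qed

text \<open>Before the first meeting \<open>P\<close> carries the bare \<open>X\<close>; afterwards
  its symbol also waits on a met chain. At a meeting the arc lies on both and is the witness
  \<open>c\<close>. At any other rank at most one of the path and that chain advances, by
  injectivity of \<open>r\<close>, and it merely copies.\<close>

lemma current_val:
  assumes "current k e"
  shows "(\<forall>f \<in> P \<inter> Q. k \<le> r f) \<and> (\<forall>X z. val X z e = X mod 2) \<or>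
    (\<exists>c \<in> frontier k. met c \<and> (\<forall>X z. val X z e = val X z c))"
  using assms
proof (induction k arbitrary: e)
  case 0
  then show ?case by (simp add: current_def)
next
  case (Suc k)
  note e = Suc.prems
  have eP: "e \<in> P" using e by (simp add: current_def)
  show ?case
  proof (cases "r e = k")
    case True
    show ?thesis
    proof (cases "e \<in> Q")
      case True
      have "e \<in> frontier (Suc k)"
        using latest_in_frontier[of e] True \<open>r e = k\<close> by simp
      moreover have "met e" using eP by (simp add: met.simps)
      ultimately show ?thesis by blast
    next
      case eQ: False
      show ?thesis
      proof (cases "e = a")
        case True
        have "Suc k \<le> r f" if f: "f \<in> P \<inter> Q" for f
        proof -
          have "k \<le> r f" using a(2)[of f] f True \<open>r e = k\<close> by auto
          moreover have "f \<noteq> e" using f eQ by blast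
          then have "r f \<noteq> k" using f eP \<open>r e = k\<close> r_neq[of e f] by simp
          ultimately show ?thesis by simp
        qed
        moreover have "\<forall>X z. val X z e = X mod 2"
          using True eP eQ by (simp add: val_copy_P)
        ultimately show ?thesis by blast
      next
        case ea: False
        have "current k (\<omega> e)"
          using \<omega>[of e] ea eP \<open>r e = k\<close> by (auto simp: current_def)
        note IH = Suc.IH[OF this]
        have v: "val X z e = val X z (\<omega> e)" for X z
          using ea eP eQ by (simp add: val_copy_P)
        have ne: "r f \<noteq> k" if "f \<in> Q" for f
        proof -
          have "f \<noteq> e" using that eQ by blast
          then show ?thesis using that eP \<open>r e = k\<close> r_neq[of e f] by simp
        qed
        have "frontier k \<subseteq> frontier (Suc k)"
          using frontier_Suc ne by blast
        moreover have "(\<forall>f \<in> P \<inter> Q. k \<le> r f) \<Longrightarrow> (\<forall>f \<in> P \<inter> Q. Suc k \<le> r f)"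
          using Suc_le_r[of "P \<inter> Q" k] ne by blast
        ultimately show ?thesis using IH unfolding v by blast
      qed
    qed
  next
    case False
    then have lt: "r e < k" using e by (auto simp: current_def)
    then have "current k e" using e by (auto simp: current_def)
    note IH = Suc.IH[OF this]
    have ne: "r f \<noteq> k" if "f \<in> P" for f
      using e that lt by (auto simp: current_def)
    from IH show ?thesis
    proof (elim disjE conjE bexE)
      assume *: "\<forall>f\<in>P \<inter> Q. k \<le> r f" and "\<forall>X z. val X z e = X mod 2"
      moreover have "\<forall>f\<in>P \<inter> Q. Suc k \<le> r f"
        using * ne Suc_le_r[of "P \<inter> Q" k] by blast
      ultimately show ?thesis by blast
    next
      fix c assume c: "c \<in> frontier k" "met c" and v: "\<forall>X z. val X z e = val X z c"
      show ?thesis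
      proof (cases "\<exists>f \<in> Q - S. \<pi> f = c \<and> r f = k")
        case True
        then obtain f where f: "f \<in> Q - S" "\<pi> f = c" "r f = k" by blast
        have "f \<notin> P" using ne f(3) by auto
        then have "met f" using c f by (subst met.simps) auto
        moreover have "f \<in> frontier (Suc k)"
          using latest_in_frontier[of f] f by simp
        moreover have "val X z f = val X z c" for X z
          using f \<open>f \<notin> P\<close> by (simp add: val_copy_Q joins_def)
        ultimately show ?thesis using v by auto
      next
        case False
        then have "c \<in> frontier (Suc k)"
          using c(1) frontier_Suc by blast
        then show ?thesis using c v by blast
      qed
    qed
  qed
qed

text \<open>At a join the symbol of \<open>P\<close> is available elsewhere: it is the message \<open>X\<close> or, by
  \<open>current_val\<close>, the symbol on a chain that \<open>P\<close> has met. That chain is not the one joined now,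
  so it is still on the next frontier and the sum can be undone.\<close>

lemma frontier_step_back:
  assumes X: "X mod 2 = X' mod 2 \<or> P \<inter> Q = {}"
    and fr: "\<And>f. f \<in> frontier (Suc k) \<Longrightarrow> val X z f = val X' z' f"
    and st: "\<And>\<sigma>. \<sigma> \<in> S \<Longrightarrow> Suc k \<le> r \<sigma> \<Longrightarrow> z \<sigma> mod 2 = z' \<sigma> mod 2"
  shows "f \<in> frontier k \<Longrightarrow> val X z f = val X' z' f"
    and "\<sigma> \<in> S \<Longrightarrow> k \<le> r \<sigma> \<Longrightarrow> z \<sigma> mod 2 = z' \<sigma> mod 2"
proof -
  \<comment> \<open>Going back over rank \<open>k\<close> can only undo the processing of one chain
    arc \<open>d\<close>, so its chain input must be recovered from the later frontier.\<close>
  have input: "if d \<in> S then z d mod 2 = z' d mod 2 else val X z (\<pi> d) = val X' z' (\<pi> d)"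
    if d: "d \<in> Q" "r d = k" for d
  proof -
    have "d \<in> frontier (Suc k)"
      using latest_in_frontier[of d] d by simp
    note vd = fr[OF this]
    show ?thesis
    proof (cases "joins d")
      case False
      show ?thesis
      proof (cases "d \<in> S")
        case True
        then have "d \<notin> P" using False by (auto simp: joins_def)
        then have "val X z d = z d mod 2" for X z
          using True a by (subst val.simps) auto
        then show ?thesis using vd True by simp
      next
        case dS: False
        then show ?thesis using vd False d by (simp add: val_copy_Q)
      qed
    next
      case True
      then have dP: "d \<in> P" by (simp add: joins_def)
      then have X: "X mod 2 = X' mod 2" using X d by auto
      have "(if d = a then X else val X z (\<omega> d)) mod 2 = (if d = a then X' else val X' z' (\<omega> d)) mod 2"
      proof (cases "d = a")
        case da: False
        have "current k (\<omega> d)"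
          using \<omega>[of d] da dP d by (auto simp: current_def)
        from current_val[OF this] show ?thesis
        proof (elim disjE conjE bexE)
          assume "\<forall>X z. val X z (\<omega> d) = X mod 2"
          then show ?thesis using X da by simp
        next
          fix c assume c: "c \<in> frontier k" "met c" and v: "\<forall>X z. val X z (\<omega> d) = val X z c"
          have "r f \<noteq> k" if f: "f \<in> Q - S" "\<pi> f = c" for f
          proof -
            have "f \<noteq> d" using f c True by (auto simp: joins_def)
            then show ?thesis using f d r_neq[of d f] by simp
          qed
          then have "c \<in> frontier (Suc k)"
            using c(1) frontier_Suc by blast
          then show ?thesis using fr v da by simp
        qed
      qed (use X in simp)
      then have "(if d \<in> S then z d else val X z (\<pi> d)) mod 2
          = (if d \<in> S then z' d else val X' z' (\<pi> d)) mod 2"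
        using vd unfolding val_join[OF True d(1)] by (rule mod_2_add_right_cancel)
      then show ?thesis by (auto split: if_splits)
    qed
  qed
  show "val X z f = val X' z' f" if f: "f \<in> frontier k"
  proof (cases "\<exists>d \<in> Q - S. \<pi> d = f \<and> r d = k")
    case True
    then show ?thesis using input by force
  next
    case False
    then have "f \<in> frontier (Suc k)"
      using f frontier_Suc by blast
    then show ?thesis by (rule fr)
  qed
  show "z \<sigma> mod 2 = z' \<sigma> mod 2" if \<sigma>: "\<sigma> \<in> S" "k \<le> r \<sigma>"
  proof (cases "r \<sigma> = k")
    case True
    then show ?thesis using input[of \<sigma>] \<sigma> S by auto
  next
    case False
    then show ?thesis using st \<sigma> by simp
  qed
qed

text \<open>Backward induction on the rank: at \<open>k\<close> all starts have been processed and
  nothing is claimed about them, at 0 every start is covered.\<close>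

lemma frontier_determines_starts:
  assumes X: "X mod 2 = X' mod 2 \<or> P \<inter> Q = {}"
    and fr: "\<And>f. f \<in> frontier k \<Longrightarrow> val X z f = val X' z' f"
    and st: "\<And>\<sigma>. \<sigma> \<in> S \<Longrightarrow> r \<sigma> < k"
    and "\<sigma> \<in> S"
  shows "z \<sigma> mod 2 = z' \<sigma> mod 2"
proof -
  have "(\<forall>f \<in> frontier j. val X z f = val X' z' f) \<and>
      (\<forall>\<sigma>\<in>S. j \<le> r \<sigma> \<longrightarrow> z \<sigma> mod 2 = z' \<sigma> mod 2)" if "j \<le> k" for j
    using that
  proof (induction j rule: inc_induct)
    case base
    then show ?case using fr st by force
  next
    case (step j)
    show ?case
      using frontier_step_back[OF X, where k = j and z = z and z' = z'] step.IH by blast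
  qed
  from this[of 0] show ?thesis using \<open>\<sigma> \<in> S\<close> by simp
qed

text \<open>A join with a chain adds the bare start symbol of a chain not met so far to a symbol of
  \<open>P\<close> containing \<open>X\<close> once; everything else copies. So the coefficient of
  \<open>X\<close> never changes from 1.\<close>

lemma val_form:
  "e \<in> P \<union> Q \<Longrightarrow>
    (if met e then \<exists>u. \<forall>X z. val X z e = (X + (\<Sum>\<sigma>\<in>S. u \<sigma> * z \<sigma>)) mod 2
     else \<exists>\<sigma>\<in>S. \<forall>X z. val X z e = z \<sigma> mod 2)"
proof (induction "r e" arbitrary: e rule: less_induct)
  case less
  have P_in: "\<exists>u. \<forall>X z. (if e = a then X mod 2 else val X z (\<omega> e)) = (X + (\<Sum>\<sigma>\<in>S. u \<sigma> * z \<sigma>)) mod 2"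
    if "e \<in> P"
  proof (cases "e = a")
    case True
    then show ?thesis by (intro exI[of _ "\<lambda>_. 0"]) auto
  next
    case False
    then have "met (\<omega> e)" using \<omega>(1)[of e] that by (subst met.simps) auto
    then show ?thesis
      using less(1)[of "\<omega> e"] \<omega>[of e] that False by auto
  qed
  show ?case
  proof (cases "e \<in> Q")
    case False
    then have e: "e \<in> P" using less.prems by blast
    then have "met e" by (simp add: met.simps)
    moreover have "val X z e = (if e = a then X mod 2 else val X z (\<omega> e))" for X z
      using e False by (simp add: val_copy_P)
    ultimately show ?thesis using P_in e by simp
  next
    case Q: True
    show ?thesis
    proof (cases "joins e")
      case True
      then have e: "e \<in> P" by (simp add: joins_def)
      have "\<exists>\<sigma>\<in>S. \<forall>X z. (if e \<in> S then z e else val X z (\<pi> e)) mod 2 = z \<sigma> mod 2"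
      proof (cases "e \<in> S")
        case False
        then have "\<not> met (\<pi> e)" using True Q by (auto simp: joins_def)
        then show ?thesis using less(1)[of "\<pi> e"] \<pi>(1,2)[of e] Q False by auto
      qed auto
      then obtain \<sigma> where \<sigma>: "\<sigma> \<in> S"
        "\<And>X z. (if e \<in> S then z e else val X z (\<pi> e)) mod 2 = z \<sigma> mod 2"
        by blast
      obtain u where u: "\<And>X z. (if e = a then X mod 2 else val X z (\<omega> e)) = (X + (\<Sum>\<sigma>\<in>S. u \<sigma> * z \<sigma>)) mod 2"
        using P_in[OF e] by blast
      \<comment> \<open>The joined chain contributes its start symbol with coefficient 1.\<close>
      define u' where "u' = u(\<sigma> := u \<sigma> + 1)"
      have sum: "(\<Sum>\<tau>\<in>S. u' \<tau> * z \<tau>) = z \<sigma> + (\<Sum>\<tau>\<in>S. u \<tau> * z \<tau>)" for z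
        using \<sigma>(1) S(2) by (simp add: u'_def sum.remove[of S \<sigma>] algebra_simps)
      have "val X z e = (X + (\<Sum>\<tau>\<in>S. u' \<tau> * z \<tau>)) mod 2" for X z
      proof -
        have "val X z e = ((if e \<in> S then z e else val X z (\<pi> e)) mod 2 +
            (if e = a then X mod 2 else val X z (\<omega> e))) mod 2"
          unfolding val_join[OF True Q] by (simp add: mod_simps)
        also have "\<dots> = (z \<sigma> mod 2 + (X + (\<Sum>\<tau>\<in>S. u \<tau> * z \<tau>)) mod 2) mod 2"
          by (simp only: \<sigma> u)
        finally show ?thesis by (simp only: sum mod_add_eq) (simp only: ac_simps)
      qed
      moreover have "met e" using e by (simp add: met.simps)
      ultimately show ?thesis by auto
    next
      case False
      show ?thesis
      proof (cases "e \<in> S")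
        case True
        then have "e \<notin> P" using False by (auto simp: joins_def)
        then have "val X z e = z e mod 2" for X z
          using True a by (subst val.simps) auto
        moreover have "\<not> met e" using True \<open>e \<notin> P\<close> by (simp add: met.simps)
        ultimately show ?thesis using True by auto
      next
        case eS: False
        have m: "met e \<longleftrightarrow> met (\<pi> e)"
          using False Q eS by (subst met.simps) (auto simp: joins_def)
        have v: "val X z e = val X z (\<pi> e)" for X z
          using Q eS False by (simp add: val_copy_Q)
        have "\<pi> e \<in> P \<union> Q" "r (\<pi> e) < r e"
          using \<pi>(1,2)[of e] Q eS by auto
        from less(1)[OF this(2) this(1)] show ?thesis unfolding m v .
      qed
    qed
  qed
qed

end

section \<open>Two sessions with connectivity 1 and 3\<close>

text \<open>The number \<open>d\<close> of proper ancestors grows along every arc. Since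
  \<open>\<iota> e < n\<close>, the number \<open>d (tail G e) * n + \<iota> e\<close> sorts arcs by
  tail and breaks ties; injectivity lets the coding argument process one arc at a time.\<close>

lemma (in network) exists_arc_rank:
  obtains r :: "'e \<Rightarrow> nat" where "inj_on r (arcs G)"
    and "\<And>e f. e \<in> arcs G \<Longrightarrow> f \<in> arcs G \<Longrightarrow> head G f = tail G e \<Longrightarrow> r f < r e"
proof -
  define d where "d v = card {u \<in> verts G. (u, v) \<in> (arcs_ends G)\<^sup>+}" for v
  have d_less: "d (tail G f) < d (head G f)" if f: "f \<in> arcs G" for f
  proof -
    have step: "(tail G f, head G f) \<in> (arcs_ends G)\<^sup>+"
      using f by (auto simp: arcs_ends_def arc_to_ends_def)
    have "tail G f \<in> {u \<in> verts G. (u, head G f) \<in> (arcs_ends G)\<^sup>+}"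
      using step f by simp
    moreover have "tail G f \<notin> {u \<in> verts G. (u, tail G f) \<in> (arcs_ends G)\<^sup>+}"
      using acyclic_arcs by (auto simp: acyclic_def)
    moreover have "{u \<in> verts G. (u, tail G f) \<in> (arcs_ends G)\<^sup>+} \<subseteq> {u \<in> verts G. (u, head G f) \<in> (arcs_ends G)\<^sup>+}"
      using step by (auto intro: trancl_trans)
    ultimately show ?thesis
      unfolding d_def by (intro psubset_card_mono) auto
  qed
  obtain \<iota> :: "'e \<Rightarrow> nat" and n where \<iota>: "inj_on \<iota> (arcs G)" "\<iota> ` arcs G = {i. i < n}"
    using finite_imp_inj_to_nat_seg[OF finite_arcs] by metis
  have \<iota>_less: "\<iota> e < n" if "e \<in> arcs G" for e
    using \<iota>(2) that by auto
  define r where "r e = d (tail G e) * n + \<iota> e" for e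
  show ?thesis
  proof (rule that[of r])
    show "inj_on r (arcs G)"
    proof (rule inj_onI)
      fix e f assume ef: "e \<in> arcs G" "f \<in> arcs G" "r e = r f"
      then have "r e mod n = r f mod n" by simp
      then have "\<iota> e = \<iota> f" using ef \<iota>_less by (simp add: r_def)
      then show "e = f" using \<iota>(1) ef by (auto dest: inj_onD)
    qed
    fix e f assume ef: "e \<in> arcs G" "f \<in> arcs G" "head G f = tail G e"
    have "r f < (d (tail G f) + 1) * n" using \<iota>_less ef by (simp add: r_def)
    also have "\<dots> \<le> d (tail G e) * n" using d_less[of f] ef by (intro mult_right_mono) auto
    also have "\<dots> \<le> r e" by (simp add: r_def)
    finally show "r f < r e" .
  qed
qed

text \<open>By \<open>balanced\<close>, arcs of \<open>A\<close> into and out of an inner node can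
  be matched bijectively. Gluing the local bijections links the arcs without building paths:
  injectivity keeps the chains disjoint, and the last property prevents them from stopping before
  \<open>t\<close>.\<close>

lemma (in minimal_cut_connected) exists_predecessor_matching:
  assumes wf: "wf_digraph G" "A \<subseteq> arcs G"
    and ends: "in_arcs G s = {}" "out_arcs G t = {}"
  obtains \<pi> where "\<And>e. e \<in> A \<Longrightarrow> tail G e \<noteq> s \<Longrightarrow> \<pi> e \<in> A \<and> head G (\<pi> e) = tail G e"
    and "inj_on \<pi> {e \<in> A. tail G e \<noteq> s}"
    and "\<And>f. f \<in> A \<Longrightarrow> head G f \<noteq> t \<Longrightarrow> \<exists>e\<in>A. tail G e \<noteq> s \<and> \<pi> e = f"
proof -
  interpret wf_digraph G by (rule wf)
  have "\<exists>h. bij_betw h {e \<in> A. tail G e = v} {e \<in> A. head G e = v}"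
    if "v \<in> verts G - {s, t}" for v
  proof (rule finite_same_card_bij)
    show "card {e \<in> A. tail G e = v} = card {e \<in> A. head G e = v}"
      by (rule balanced[symmetric]) (use that in auto)
  qed (use fin in auto)
  then have "\<forall>v \<in> verts G - {s, t}. \<exists>h. bij_betw h {e \<in> A. tail G e = v} {e \<in> A. head G e = v}"
    by blast
  from bchoice[OF this] obtain h where h: "\<And>v. v \<in> verts G - {s, t} \<Longrightarrow>
      bij_betw (h v) {e \<in> A. tail G e = v} {e \<in> A. head G e = v}"
    by blast
  have inner_tail: "tail G e \<in> verts G - {s, t}" if "e \<in> A" "tail G e \<noteq> s" for e
  proof -
    have "e \<in> out_arcs G (tail G e)" using that(1) wf(2) by auto
    then have "tail G e \<noteq> t" using ends(2) by (metis emptyE)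
    then show ?thesis using that wf(2) by auto
  qed
  have inner_head: "head G e \<in> verts G - {s, t}" if "e \<in> A" "head G e \<noteq> t" for e
  proof -
    have "e \<in> in_arcs G (head G e)" using that(1) wf(2) by auto
    then have "head G e \<noteq> s" using ends(1) by (metis emptyE)
    then show ?thesis using that wf(2) by auto
  qed
  define \<pi> where "\<pi> e = h (tail G e) e" for e
  have \<pi>: "\<pi> e \<in> A \<and> head G (\<pi> e) = tail G e" if "e \<in> A" "tail G e \<noteq> s" for e
    using bij_betwE[OF h[OF inner_tail[OF that]]] that(1) by (auto simp: \<pi>_def)
  show ?thesis
  proof (rule that[of \<pi>])
    show "inj_on \<pi> {e \<in> A. tail G e \<noteq> s}"
    proof (rule inj_onI)
      fix e f assume e: "e \<in> {e \<in> A. tail G e \<noteq> s}" and f: "f \<in> {e \<in> A. tail G e \<noteq> s}"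
        and eq: "\<pi> e = \<pi> f"
      then have "tail G e = tail G f" using \<pi>[of e] \<pi>[of f] by auto
      with e f eq show "e = f"
        using bij_betw_imp_inj_on[OF h[OF inner_tail[of e]]] by (auto simp: \<pi>_def dest: inj_onD)
    qed
    fix f assume f: "f \<in> A" "head G f \<noteq> t"
    have "f \<in> h (head G f) ` {e \<in> A. tail G e = head G f}"
      using bij_betw_imp_surj_on[OF h[OF inner_head[OF f]]] f by simp
    then obtain e where e: "e \<in> A" "tail G e = head G f" "h (head G f) e = f" by force
    then have "tail G e \<noteq> s" "\<pi> e = f"
      using inner_head[OF f] by (auto simp: \<pi>_def)
    then show "\<exists>e\<in>A. tail G e \<noteq> s \<and> \<pi> e = f"
      using e(1) by blast
  qed (use \<pi> in auto)
qed

text \<open>No arc leaves the set of nodes reachable from \<open>s\<close>; if \<open>t\<close> were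
  outside, this cut would bound the flow by 0.\<close>

lemma (in fin_digraph) exists_awalk_if_max_flow_pos:
  assumes "0 < max_flow G s t" "s \<in> verts G"
  shows "\<exists>p. awalk s p t"
proof -
  let ?S = "{v \<in> verts G. s \<rightarrow>\<^sup>* v}"
  have "leaving G (arcs G) ?S = {}"
  proof (rule ccontr)
    assume "leaving G (arcs G) ?S \<noteq> {}"
    then obtain e where e: "e \<in> arcs G" "s \<rightarrow>\<^sup>* tail G e" "head G e \<notin> ?S"
      by (auto simp: leaving_def)
    then have "s \<rightarrow>\<^sup>* head G e"
      by (meson in_arcs_imp_in_arcs_ends reachable_adj_trans)
    then show False using e by auto
  qed
  then have "t \<in> ?S"
    using assms max_flow_le_cut[of ?S s t] by force
  then show ?thesis
    by (simp add: reachable_awalk)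
qed

lemma (in pre_digraph) cas_nth:
  "cas u p v \<Longrightarrow> Suc i < length p \<Longrightarrow> head G (p ! i) = tail G (p ! Suc i)"
proof (induction p arbitrary: u i)
  case (Cons e p)
  then show ?case by (cases p; cases i) auto
qed simp

lemma (in pre_digraph) cas_ends_nth:
  "cas u p v \<Longrightarrow> p \<noteq> [] \<Longrightarrow> tail G (p ! 0) = u \<and> head G (last p) = v"
proof (induction p arbitrary: u)
  case (Cons e p)
  then show ?case by (cases p) auto
qed simp

text \<open>One symbol \<open>X\<close> is observed at \<open>s1\<close> and two symbols \<open>a\<close>, \<open>b\<close> at \<open>s2\<close>; arithmetic is modulo 2.\<close>

definition scalar_code ::
  "('v, 'e) pre_digraph \<Rightarrow> 'v \<Rightarrow> 'v \<Rightarrow> (nat \<Rightarrow> nat \<Rightarrow> nat \<Rightarrow> 'e \<Rightarrow> nat) \<Rightarrow> bool" where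
  "scalar_code G s1 s2 y \<longleftrightarrow>
     (\<exists>K h m1 m2. \<forall>e \<in> arcs G.
        (h e \<noteq> 0 \<longrightarrow> tail G e = s1) \<and> (m1 e \<noteq> 0 \<or> m2 e \<noteq> 0 \<longrightarrow> tail G e = s2) \<and>
        (\<forall>X a b. y X a b e =
          ((\<Sum>f \<in> in_arcs G (tail G e). K e f * y X a b f) + h e * X + (m1 e * a + m2 e * b)) mod 2))"

text \<open>\<open>B\<close> and \<open>C\<close> are to carry free symbols x and y, and
  \<open>A\<close> the symbol u B * x + u C * y. The interference becomes (u A + 1) * (u B * x + u C
  * y), which is even under either alternative.\<close>

lemma exists_three_starts:
  fixes u :: "'e \<Rightarrow> nat"
  assumes "3 \<le> card S"
  obtains A B C where "{A, B, C} \<subseteq> S" "A \<noteq> B" "A \<noteq> C" "B \<noteq> C"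
    and "odd (u A) \<or> even (u B) \<and> even (u C)"
proof -
  obtain T where "T \<subseteq> S" "card T = 3"
    by (rule obtain_subset_with_card_n[OF assms])
  then obtain A B C where ABC: "{A, B, C} \<subseteq> S" "A \<noteq> B" "A \<noteq> C" "B \<noteq> C"
    by (auto simp: card_3_iff)
  consider "odd (u A)" | "odd (u B)" | "odd (u C)" | "even (u B) \<and> even (u C)"
    by blast
  then show ?thesis
  proof cases
    case 1
    then show ?thesis using ABC by (intro that[of A B C]) auto
  next
    case 2
    then show ?thesis using ABC by (intro that[of B A C]) auto
  next
    case 3
    then show ?thesis using ABC by (intro that[of C A B]) auto
  next
    case 4
    then show ?thesis using ABC by (intro that[of A B C]) auto
  qed
qed

lemma (in network) two_session_code:
  assumes s1: "s1 \<in> verts G" "in_arcs G s1 = {}" and t1: "out_arcs G t1 = {}" "max_flow G s1 t1 \<ge> 1"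
    and s2: "s2 \<in> verts G" "in_arcs G s2 = {}" and t2: "out_arcs G t2 = {}" "max_flow G s2 t2 \<ge> 3"
  obtains y where "scalar_code G s1 s2 y"
    and "\<exists>l \<in> in_arcs G t1. \<forall>X a b. y X a b l = X mod 2"
    and "\<And>X a b X' a' b'. \<forall>e \<in> in_arcs G t2. y X a b e = y X' a' b' e \<Longrightarrow>
      a mod 2 = a' mod 2 \<and> b mod 2 = b' mod 2"
proof -
  obtain r :: "'e \<Rightarrow> nat" where inj_r: "inj_on r (arcs G)"
    and r_less: "\<And>e f. e \<in> arcs G \<Longrightarrow> f \<in> arcs G \<Longrightarrow> head G f = tail G e \<Longrightarrow> r f < r e"
    using exists_arc_rank by blast

  obtain Q where Q: "Q \<subseteq> arcs G" and "minimal_cut_connected G s2 t2 3 Q"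
    using exists_minimal_cut_connected[of "arcs G" G s2 t2 3] max_flow_imp_cut_connected[of 3 s2 t2] t2
    by auto
  interpret Q: minimal_cut_connected G s2 t2 3 Q by fact
  obtain \<pi> where \<pi>: "\<And>e. e \<in> Q \<Longrightarrow> tail G e \<noteq> s2 \<Longrightarrow> \<pi> e \<in> Q \<and> head G (\<pi> e) = tail G e"
    and inj_\<pi>: "inj_on \<pi> {e \<in> Q. tail G e \<noteq> s2}"
    and surj_\<pi>: "\<And>f. f \<in> Q \<Longrightarrow> head G f \<noteq> t2 \<Longrightarrow> \<exists>e\<in>Q. tail G e \<noteq> s2 \<and> \<pi> e = f"
    using Q.exists_predecessor_matching[OF wf_digraph_axioms Q s2(2) t2(1)] by blast
  define S where "S = {e \<in> Q. tail G e = s2}"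
  have QS: "Q - S = {e \<in> Q. tail G e \<noteq> s2}" by (auto simp: S_def)
  \<comment> \<open>This makes \<open>{s2}\<close> a cut, whence at least three chain
    starts.\<close>
  have "s2 \<noteq> t2" using max_flow_isolated[of G s2 t2] s2 t2 by auto
  then have "3 \<le> card (leaving G Q {s2})"
    using s2 by (intro Q.card_leaving_ge) auto
  also have "\<dots> \<le> card S"
    using Q.fin by (intro card_mono) (auto simp: leaving_def S_def)
  finally have card_S: "3 \<le> card S" .

  obtain p where p: "awalk s1 p t1"
    using exists_awalk_if_max_flow_pos[of s1 t1] s1 t1 by auto
  have p_ne: "p \<noteq> []"
    using p max_flow_isolated[of G s1 t1] s1 t1 by (auto simp: awalk_Nil_iff)
  define P where "P = set p"
  define n where "n = length p"
  have n: "0 < n" using p_ne by (simp add: n_def)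
  have P: "P \<subseteq> arcs G" using p by (simp add: P_def awalk_def)
  have P_nth: "e \<in> P \<longleftrightarrow> (\<exists>i<n. e = p ! i)" for e
    by (auto simp: P_def n_def in_set_conv_nth)
  have p_step: "head G (p ! i) = tail G (p ! Suc i)" if "Suc i < n" for i
    using cas_nth that p by (auto simp: awalk_def n_def)
  have p_less: "r (p ! i) < r (p ! j)" if "i < j" "j < n" for i j
    using that
  proof (induction j)
    case (Suc j)
    have "p ! j \<in> arcs G" "p ! Suc j \<in> arcs G"
      using Suc.prems P by (auto simp: P_def n_def)
    then have "r (p ! j) < r (p ! Suc j)" using r_less p_step Suc.prems by blast
    then show ?case using Suc by (cases "i = j") auto
  qed simp
  have p_le: "r (p ! i) \<le> r (p ! j)" if "i \<le> j" "j < n" for i j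
    using p_less[of i j] that by (cases "i = j") auto
  define a where "a = p ! 0"
  have a: "a \<in> P" "tail G a = s1"
    using cas_ends_nth p p_ne n by (auto simp: a_def P_nth awalk_def)
  \<comment> \<open>Ranks increase strictly along the walk, so its arcs are distinct and
    \<open>LEAST\<close> selects the only position.\<close>
  define idx where "idx e = (LEAST i. i < n \<and> e = p ! i)" for e
  have idx: "idx e < n \<and> e = p ! idx e" if "e \<in> P" for e
    using LeastI_ex[of "\<lambda>i. i < n \<and> e = p ! i"] that by (simp add: idx_def P_nth)
  define \<omega> where "\<omega> e = p ! (idx e - 1)" for e
  have idx_pos: "0 < idx e" if "e \<in> P - {a}" for e
    using idx[of e] that by (metis DiffE a_def insertI1 neq0_conv)

  interpret C: crossing_chains r P Q S a \<omega> \<pi>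
  proof
    show "inj_on r (P \<union> Q)" using inj_r P Q by (meson Un_least inj_on_subset)
    show "r a \<le> r e" if "e \<in> P" for e
      using that p_le[of 0] by (auto simp: P_nth a_def)
    fix e assume e: "e \<in> P - {a}"
    have "idx e - 1 < n" using idx[of e] e by auto
    then show "\<omega> e \<in> P" unfolding \<omega>_def P_nth by blast
    show "r (\<omega> e) < r e" using idx[of e] idx_pos[OF e] e p_less[of "idx e - 1" "idx e"] by (simp add: \<omega>_def)
    fix f assume f: "f \<in> P" "r f < r e"
    then have "idx f < idx e"
      using idx[of e] idx[of f] e p_le[of "idx e" "idx f"] by (metis DiffD1 leD not_le)
    then have "idx f \<le> idx e - 1" "idx e - 1 < n"
      using idx[of e] e by auto
    then have "r (p ! idx f) \<le> r (\<omega> e)"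
      unfolding \<omega>_def by (rule p_le)
    then show "r f \<le> r (\<omega> e)"
      using idx[OF f(1)] by simp
  next
    fix e assume e: "e \<in> Q - S"
    then have "e \<in> Q" "tail G e \<noteq> s2" by (auto simp: S_def)
    then show "\<pi> e \<in> Q" "r (\<pi> e) < r e" using \<pi>[of e] r_less[of e "\<pi> e"] Q by auto
  next
    show "finite S" using Q.fin by (simp add: S_def)
    show "S \<subseteq> Q" by (auto simp: S_def)
    show "inj_on \<pi> (Q - S)" using inj_\<pi> by (simp only: QS)
  qed (use a in auto)

  define l where "l = last p"
  have l: "l \<in> P" "l = p ! (n - 1)" "head G l = t1"
    using p_ne cas_ends_nth p by (auto simp: l_def P_def n_def last_conv_nth awalk_def)
  \<comment> \<open>At \<open>N\<close> all arcs are processed: the frontier consists of chain ends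
    at \<open>t2\<close>, and \<open>P\<close> stands on its last arc \<open>l\<close>.\<close>
  define N where "N = Suc (Max (r ` (P \<union> Q)))"
  have N: "r e < N" if "e \<in> P \<union> Q" for e
    using that Q.fin P by (auto simp: N_def P_def less_Suc_eq_le intro!: Max_ge)
  have frontier_N: "C.frontier N \<subseteq> in_arcs G t2"
  proof
    fix c assume c: "c \<in> C.frontier N"
    then have cQ: "c \<in> Q" by (simp add: C.frontier_def)
    have "head G c = t2"
    proof (rule ccontr)
      assume "head G c \<noteq> t2"
      then obtain e where "e \<in> Q - S" "\<pi> e = c" using surj_\<pi> cQ QS by blast
      then show False using c N[of e] by (auto simp: C.frontier_def)
    qed
    then show "c \<in> in_arcs G t2" using cQ Q by auto
  qed
  have "C.current N l"
    using l N p_le[of _ "n - 1"] n by (fastforce simp: C.current_def P_nth)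
  then have l_val: "(\<forall>f \<in> P \<inter> Q. N \<le> r f) \<or>
      (\<exists>c \<in> C.frontier N. \<forall>X z. C.val X z l = C.val X z c)"
    using C.current_val by blast
  have l_cases: "P \<inter> Q = {} \<or> (\<exists>c \<in> in_arcs G t2. \<forall>X z. C.val X z l = C.val X z c)"
    using l_val
  proof
    assume *: "\<forall>f \<in> P \<inter> Q. N \<le> r f"
    have "f \<notin> P \<inter> Q" for f using * N[of f] by force
    then show ?thesis by blast
  qed (use frontier_N in blast)

  have "C.met l" using l(1) by (simp add: C.met.simps)
  then obtain u where u: "\<And>X z. C.val X z l = (X + (\<Sum>\<sigma>\<in>S. u \<sigma> * z \<sigma>)) mod 2"
    using C.val_form[of l] l(1) by auto
  obtain A B D where ABD: "{A, B, D} \<subseteq> S" "A \<noteq> B" "A \<noteq> D" "B \<noteq> D"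
    and odd_even: "odd (u A) \<or> even (u B) \<and> even (u D)"
    using exists_three_starts[OF card_S] by metis

  \<comment> \<open>Makes the interference \<open>\<Sum>\<sigma>\<in>S. u \<sigma> * z x y \<sigma>\<close> at \<open>t1\<close> even.\<close>
  define z where "z x y \<sigma> = (if \<sigma> = A then u B * x + u D * y else if \<sigma> = B then x else if \<sigma> = D then y else 0)"
    for x y \<sigma>
  have val_l: "C.val X (z x y) l = X mod 2" for X x y
  proof -
    \<comment> \<open>\<open>card S\<close> is only bounded from below; starts other than
      \<open>A\<close>, \<open>B\<close>, \<open>D\<close> send 0.\<close>
    have "(\<Sum>\<sigma>\<in>S. u \<sigma> * z x y \<sigma>) = (\<Sum>\<sigma>\<in>{A, B, D}. u \<sigma> * z x y \<sigma>)"
      using ABD(1) C.S(2) by (intro sum.mono_neutral_right) (auto simp: z_def)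
    also have "\<dots> = (u A + 1) * (u B * x + u D * y)"
      using ABD by (simp add: z_def algebra_simps)
    finally have "even (\<Sum>\<sigma>\<in>S. u \<sigma> * z x y \<sigma>)"
      using odd_even by auto
    then show ?thesis
      unfolding u by (metis add_0_right even_iff_mod_2_eq_zero mod_add_right_eq)
  qed

  show ?thesis
  proof (rule that[of "\<lambda>X x y. C.val X (z x y)"])
    show "\<exists>l \<in> in_arcs G t1. \<forall>X x y. C.val X (z x y) l = X mod 2"
      using l P val_l by (intro bexI[of _ l]) auto
    fix X x y X' x' y'
    assume eq: "\<forall>e \<in> in_arcs G t2. C.val X (z x y) e = C.val X' (z x' y') e"
    \<comment> \<open>If \<open>P\<close> meets \<open>Q\<close>, some arc into \<open>t2\<close>
      carries the symbol of \<open>l\<close>, which by the choice of \<open>z\<close> is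
      \<open>X\<close> itself.\<close>
    have "X mod 2 = X' mod 2 \<or> P \<inter> Q = {}"
      using l_cases eq val_l by metis
    then have z: "z x y \<sigma> mod 2 = z x' y' \<sigma> mod 2" if "\<sigma> \<in> S" for \<sigma>
    proof (rule C.frontier_determines_starts)
      show "C.val X (z x y) f = C.val X' (z x' y') f" if "f \<in> C.frontier N" for f
        using that frontier_N eq by blast
      show "r \<tau> < N" if "\<tau> \<in> S" for \<tau>
        using N[of \<tau>] C.S(1) that by blast
    qed fact
    show "x mod 2 = x' mod 2 \<and> y mod 2 = y' mod 2"
      using z[of B] z[of D] ABD by (auto simp: z_def)
  next
    \<comment> \<open>\<open>z\<close> is linear in \<open>x\<close> and \<open>y\<close>, so its
      values at (1, 0) and (0, 1) are the coefficients.\<close>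
    define m1 where "m1 e = (if e \<in> S then z 1 0 e else 0)" for e
    define m2 where "m2 e = (if e \<in> S then z 0 1 e else 0)" for e
    define h :: "'e \<Rightarrow> nat" where "h e = (if e = a \<and> C.joins e then 1 else 0)" for e
    \<comment> \<open>Chain and path input get separate coefficients, so
      \<open>\<pi> e = \<omega> e\<close> needs no case of its own.\<close>
    define K1 :: "'e \<Rightarrow> 'e \<Rightarrow> nat" where "K1 e f = (if f = \<pi> e then if e \<in> Q - S then 1 else 0 else 0)" for e f
    define K2 :: "'e \<Rightarrow> 'e \<Rightarrow> nat" where "K2 e f = (if f = \<omega> e then if e \<in> P - {a} \<and> C.joins e then 1 else 0 else 0)" for e f
    have "C.val X (z x y) e = ((\<Sum>f \<in> in_arcs G (tail G e). (K1 e f + K2 e f) * C.val X (z x y) f)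
        + h e * X + (m1 e * x + m2 e * y)) mod 2" for X x y e
    proof -
      let ?v = "C.val X (z x y)" and ?I = "in_arcs G (tail G e)"
      have \<pi>_in: "\<pi> e \<in> ?I" if "e \<in> Q - S"
        using \<pi>[of e] that Q by (auto simp: S_def)
      have \<omega>_in: "\<omega> e \<in> ?I" if e: "e \<in> P - {a}"
      proof -
        have "head G (\<omega> e) = tail G e"
          using p_step[of "idx e - 1"] idx[of e] idx_pos[OF e] e by (simp add: \<omega>_def)
        then show ?thesis using C.\<omega>(1)[OF e] P by auto
      qed
      have "(\<Sum>f\<in>?I. K1 e f * ?v f) = (\<Sum>f\<in>?I. if f = \<pi> e then if e \<in> Q - S then ?v f else 0 else 0)"
        by (intro sum.cong) (auto simp: K1_def)
      also have "\<dots> = (if e \<in> Q - S then ?v (\<pi> e) else 0)"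
        using \<pi>_in by (subst sum.delta) auto
      finally have K1: "(\<Sum>f\<in>?I. K1 e f * ?v f) = (if e \<in> Q - S then ?v (\<pi> e) else 0)" .
      have "(\<Sum>f\<in>?I. K2 e f * ?v f) = (\<Sum>f\<in>?I. if f = \<omega> e then if e \<in> P - {a} \<and> C.joins e then ?v f else 0 else 0)"
        by (intro sum.cong) (auto simp: K2_def)
      also have "\<dots> = (if e \<in> P - {a} \<and> C.joins e then ?v (\<omega> e) else 0)"
        using \<omega>_in by (subst sum.delta) auto
      finally have K2: "(\<Sum>f\<in>?I. K2 e f * ?v f) = (if e \<in> P - {a} \<and> C.joins e then ?v (\<omega> e) else 0)" .
      have m: "m1 e * x + m2 e * y = (if e \<in> S then z x y e else 0)"
        by (simp add: m1_def m2_def z_def)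
      show ?thesis
        unfolding distrib_right sum.distrib K1 K2 m h_def
        by (subst C.val.simps) (auto simp: ac_simps S_def)
    qed
    moreover have "h e \<noteq> 0 \<longrightarrow> tail G e = s1" for e
      using a(2) by (simp add: h_def)
    moreover have "m1 e \<noteq> 0 \<or> m2 e \<noteq> 0 \<longrightarrow> tail G e = s2" for e
      by (simp add: m1_def m2_def S_def)
    ultimately show "scalar_code G s1 s2 (\<lambda>X x y. C.val X (z x y))"
      unfolding scalar_code_def
      by (intro exI[of _ "\<lambda>e f. K1 e f + K2 e f"] exI[of _ h] exI[of _ m1] exI[of _ m2] ballI conjI allI)
  qed
qed

section \<open>Two interleaved scalar codes as a vector code\<close>

definition F2 :: "nat ring" where
  "F2 = \<lparr>carrier = {0, 1}, mult = (*), one = 1, zero = 0, add = (\<lambda>a b. (a + b) mod 2)\<rparr>"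

lemma F2_simps [simp]:
  "carrier F2 = {0, 1}" "x \<otimes>\<^bsub>F2\<^esub> y = x * y" "\<one>\<^bsub>F2\<^esub> = 1" "\<zero>\<^bsub>F2\<^esub> = 0" "x \<oplus>\<^bsub>F2\<^esub> y = (x + y) mod 2"
  by (simp_all add: F2_def)

lemma field_F2: "field F2"
proof -
  have "cring F2"
  proof (rule cringI)
    show "abelian_group F2"
      by (rule abelian_groupI) auto
    show "comm_monoid F2"
      by (rule comm_monoidI) auto
  qed auto
  moreover have "Units F2 = carrier F2 - {\<zero>\<^bsub>F2\<^esub>}"
    by (auto simp: Units_def)
  ultimately show ?thesis
    by (rule cring.cring_fieldI)
qed

lemma matrix_in_linear_maps:
  fixes c :: "nat \<Rightarrow> 'i \<Rightarrow> nat"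
  shows "(\<lambda>w. \<lambda>k\<in>K. (\<Sum>i\<in>I. c k i * w i) mod 2)
    \<in> linear_maps F2 (coord_space F2 I) (coord_space F2 K)"
proof -
  let ?L = "\<lambda>w. \<lambda>k\<in>K. (\<Sum>i\<in>I. c k i * w i) mod 2"
  have add: "(\<Sum>i\<in>I. c k i * ((w i + w' i) mod 2)) mod 2
      = ((\<Sum>i\<in>I. c k i * w i) mod 2 + (\<Sum>i\<in>I. c k i * w' i) mod 2) mod 2" for k w w'
  proof -
    have "(\<Sum>i\<in>I. c k i * ((w i + w' i) mod 2)) mod 2 = (\<Sum>i\<in>I. c k i * (w i + w' i)) mod 2"
      by (subst (1 2) mod_sum_eq[symmetric]) (simp only: mod_mult_right_eq)
    then show ?thesis
      by (simp only: distrib_left sum.distrib mod_add_eq)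
  qed
  have smult: "(\<Sum>i\<in>I. c k i * (a * w i)) mod 2 = a * ((\<Sum>i\<in>I. c k i * w i) mod 2)"
    if "a \<in> {0, 1}" for a k w
    using that by auto
  have "?L \<in> carrier (coord_space F2 I) \<rightarrow> carrier (coord_space F2 K)"
    by (auto simp: coord_space_def)
  then show ?thesis
    using add smult
    by (auto simp: linear_maps_def hom_def coord_space_def intro!: restrict_ext sum.cong
        cong: restrict_cong)
qed

lemma scalar_codeE:
  assumes "scalar_code G s1 s2 y" "e \<in> arcs G"
  obtains K h m1 m2 where "h \<noteq> 0 \<longrightarrow> tail G e = s1" "m1 \<noteq> 0 \<or> m2 \<noteq> 0 \<longrightarrow> tail G e = s2"
    and "\<forall>X a b. y X a b e =
      ((\<Sum>f \<in> in_arcs G (tail G e). K f * y X a b f) + h * X + (m1 * a + m2 * b)) mod 2"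
proof -
  from assms(1)[unfolded scalar_code_def] show ?thesis
  proof (elim exE)
    fix K h m1 m2
    assume "\<forall>e \<in> arcs G.
        (h e \<noteq> 0 \<longrightarrow> tail G e = s1) \<and> (m1 e \<noteq> 0 \<or> m2 e \<noteq> 0 \<longrightarrow> tail G e = s2) \<and>
        (\<forall>X a b. y X a b e =
          ((\<Sum>f \<in> in_arcs G (tail G e). K e f * y X a b f) + h e * X + (m1 e * a + m2 e * b)) mod 2)"
    from bspec[OF this assms(2)] show ?thesis
      by (elim conjE) (rule that)
  qed
qed

text \<open>Slot \<open>k\<close> of an arc depends on incoming arcs only through their slot
  \<open>k\<close>, so the scalar codes do not interact. Message symbols, however, may change
  position: both symbols of session \<open>k + 2\<close> enter slot \<open>k\<close>.\<close>

lemma interleaved_linear_network_code: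
  assumes "fin_digraph G"
    and code: "\<And>k. k < 2 \<Longrightarrow> scalar_code G (s 1) (s (k + 2)) (y k)"
  shows "linear_network_code F2 2 G 3 s
    (\<lambda>x e. \<lambda>k\<in>{..<2}. y k (x 1 k) (x (k + 2) 0) (x (k + 2) 1) e)" (is "linear_network_code _ _ _ _ _ ?y")
  unfolding linear_network_code_def
proof
  interpret fin_digraph G by fact
  fix e assume e: "e \<in> arcs G"
  let ?A = "in_arcs G (tail G e)" and ?J = "{i \<in> {1..3}. s i = tail G e}"
  let ?I = "input_index G 3 s (tail G e) \<times> {..<2}"
  let ?w = "\<lambda>x. node_input G 3 s 2 (tail G e) x (?y x)"
  have "\<exists>c. \<forall>x. y k (x 1 k) (x (k + 2) 0) (x (k + 2) 1) e = (\<Sum>i\<in>?I. c i * ?w x i) mod 2"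
    if k: "k < 2" for k
  proof -
    obtain K h m1 m2 where h: "h \<noteq> 0 \<longrightarrow> tail G e = s 1"
      and m: "m1 \<noteq> 0 \<or> m2 \<noteq> 0 \<longrightarrow> tail G e = s (k + 2)"
      and y: "\<forall>X a b. y k X a b e = ((\<Sum>f\<in>?A. K f * y k X a b f) + h * X + (m1 * a + m2 * b)) mod 2"
      by (rule scalar_codeE[OF code[OF k] e]) (rule that)
    define d :: "nat \<Rightarrow> nat \<Rightarrow> nat" where
      "d i l = (if i = 1 \<and> l = k then h else 0) +
        (if i = k + 2 then if l = 0 then m1 else m2 else 0)" for i l
    define c where
      "c j = (case j of (Inl f, l) \<Rightarrow> if l = k then K f else 0 | (Inr i, l) \<Rightarrow> d i l)" for j
    have "(\<Sum>i\<in>?I. c i * ?w x i) =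
        (\<Sum>f\<in>?A. K f * ?y x f k) + h * x 1 k + (m1 * x (k + 2) 0 + m2 * x (k + 2) 1)"
      for x
    proof -
      have "(\<Sum>i\<in>?I. c i * ?w x i) = (\<Sum>i\<in>?I. case i of (j, l) \<Rightarrow>
          c (j, l) * (case j of Inl f \<Rightarrow> ?y x f l | Inr i \<Rightarrow> x i l))"
        by (intro sum.cong) (auto simp: node_input_def split: sum.split)
      also have "\<dots> = (\<Sum>j\<in>?A <+> ?J. \<Sum>l<2. c (j, l) * (case j of Inl f \<Rightarrow> ?y x f l | Inr i \<Rightarrow> x i l))"
        by (simp only: sum.cartesian_product input_index_def)
      also have "\<dots> = (\<Sum>f\<in>?A. \<Sum>l<2. c (Inl f, l) * ?y x f l) + (\<Sum>i\<in>?J. \<Sum>l<2. c (Inr i, l) * x i l)"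
        by (subst sum.Plus) auto
      also have "(\<Sum>f\<in>?A. \<Sum>l<2. c (Inl f, l) * ?y x f l) = (\<Sum>f\<in>?A. K f * ?y x f k)"
      proof (rule sum.cong)
        fix f
        have "(\<Sum>l<2. c (Inl f, l) * ?y x f l) = (\<Sum>l<2. if l = k then K f * ?y x f l else 0)"
          by (intro sum.cong) (auto simp: c_def)
        also have "\<dots> = K f * ?y x f k"
          using k by (subst sum.delta) auto
        finally show "(\<Sum>l<2. c (Inl f, l) * ?y x f l) = K f * ?y x f k" .
      qed simp
      also have "(\<Sum>i\<in>?J. \<Sum>l<2. c (Inr i, l) * x i l) = (\<Sum>i\<in>{1..3}. \<Sum>l<2. d i l * x i l)"
      proof (rule sum.mono_neutral_cong_left)
        \<comment> \<open>Coefficients of messages not observed at this node vanish, so the sum may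
          run over all sessions, even if sources coincide.\<close>
        show "\<forall>i\<in>{1..3} - ?J. (\<Sum>l<2. d i l * x i l) = 0"
        proof
          fix i assume "i \<in> {1..3} - ?J"
          then have "s i \<noteq> tail G e" by auto
          then have "d i l = 0" for l
            using h m by (auto simp: d_def)
          then show "(\<Sum>l<2. d i l * x i l) = 0" by simp
        qed
      qed (auto simp: c_def)
      also have "\<dots> = h * x 1 k + (m1 * x (k + 2) 0 + m2 * x (k + 2) 1)"
      proof -
        have sum2: "(\<Sum>l<2. f l) = f 0 + f 1" for f :: "nat \<Rightarrow> nat"
          by (simp add: numeral_2_eq_2)
        have sum3: "(\<Sum>i\<in>{1..3}. f i) = f 1 + f 2 + f 3" for f :: "nat \<Rightarrow> nat"
          by (simp add: numeral_3_eq_3 numeral_2_eq_2)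
        from k consider "k = 0" | "k = 1" by linarith
        then show ?thesis
          unfolding sum2 sum3 by cases (simp_all add: d_def numeral_2_eq_2 numeral_3_eq_3)
      qed
      finally show ?thesis by (simp only: add.assoc)
    qed
    then show ?thesis
      using k by (intro exI[of _ c]) (simp add: y)
  qed
  then have "\<forall>k\<in>{..<2}. \<exists>c. \<forall>x. y k (x 1 k) (x (k + 2) 0) (x (k + 2) 1) e = (\<Sum>i\<in>?I. c i * ?w x i) mod 2"
    by simp
  from bchoice[OF this] obtain c where c: "\<forall>k\<in>{..<2}. \<forall>x.
      y k (x 1 k) (x (k + 2) 0) (x (k + 2) 1) e = (\<Sum>i\<in>?I. c k i * ?w x i) mod 2"
    by blast
  let ?L = "\<lambda>w. \<lambda>k\<in>{..<2}. (\<Sum>i\<in>?I. c k i * w i) mod 2"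
  show "\<exists>L\<in>linear_maps F2 (coord_space F2 ?I) (coord_space F2 {..<2}).
      \<forall>x\<in>messages F2 2 3. ?y x e = L (?w x)"
  proof (intro bexI[of _ ?L] ballI matrix_in_linear_maps)
    show "?y x e = ?L (?w x)" for x
    proof (rule restrict_ext)
      fix k assume k: "k \<in> {..<2 :: nat}"
      show "y k (x 1 k) (x (k + 2) 0) (x (k + 2) 1) e = (\<Sum>i\<in>?I. c k i * ?w x i) mod 2"
        by (rule spec[OF bspec[OF c k]])
    qed
  qed
qed

text \<open>If the input of \<open>t i\<close> determines message \<open>i\<close>, a decoder can
  pick any message family consistent with what is received.\<close>

lemma recovers_messagesI:
  assumes "\<And>i x x'. i \<in> {1..n} \<Longrightarrow> x \<in> messages F T n \<Longrightarrow> x' \<in> messages F T n \<Longrightarrow>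
    (\<And>e. e \<in> in_arcs G (t i) \<Longrightarrow> y x e = y x' e) \<Longrightarrow> x i = x' i"
  shows "recovers_messages F T G n t y"
  unfolding recovers_messages_def
proof
  fix i assume i: "i \<in> {1..n}"
  let ?R = "\<lambda>x. restrict (y x) (in_arcs G (t i))"
  define dec where "dec d = (SOME x. x \<in> messages F T n \<and> ?R x = d) i" for d
  have "dec (?R x) = x i" if x: "x \<in> messages F T n" for x
  proof -
    have "\<exists>x'. x' \<in> messages F T n \<and> ?R x' = ?R x" using x by blast
    from someI_ex[OF this] obtain x' where x': "x' \<in> messages F T n" "?R x' = ?R x" "dec (?R x) = x' i"
      unfolding dec_def by blast
    have "y x' e = y x e" if "e \<in> in_arcs G (t i)" for e
    proof -
      have "?R x' e = ?R x e" using x'(2) by simp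
      then show ?thesis using that by simp
    qed
    then show ?thesis
      using assms[OF i x'(1) x] x'(3) by simp
  qed
  then show "\<exists>dec. \<forall>x\<in>messages F T n. dec (?R x) = x i" by blast
qed

lemma message_F2_cong:
  assumes x: "x \<in> messages F2 2 n" and x': "x' \<in> messages F2 2 n" and i: "i \<in> {1..n}"
    and "x i 0 mod 2 = x' i 0 mod 2" "x i 1 mod 2 = x' i 1 mod 2"
  shows "x i = x' i"
proof -
  have xi: "x i \<in> {..<2} \<rightarrow>\<^sub>E {0, 1}" and xi': "x' i \<in> {..<2} \<rightarrow>\<^sub>E {0, 1}"
    using PiE_mem[OF x[unfolded messages_def] i] PiE_mem[OF x'[unfolded messages_def] i]
    by (auto simp: coord_space_def)
  show ?thesis
  proof (rule PiE_ext[OF xi xi'])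
    fix k :: nat assume k: "k \<in> {..<2}"
    have "x i k mod 2 = x' i k mod 2"
      using assms(4,5) k by (auto simp: less_2_cases_iff)
    moreover have "x i k \<in> {0, 1}" "x' i k \<in> {0, 1}"
      using xi xi' k by (auto dest: PiE_mem)
    ultimately show "x i k = x' i k" by auto
  qed
qed

theorem mainTheorem7:
  fixes G :: "('v, 'e) pre_digraph" and s t :: "nat \<Rightarrow> 'v"
  assumes "multiple_unicast G 3 s t"
    and "connectivity_level G 3 s t = [1, 3, 3]"
  shows "feasible G 3 s t"
proof -
  interpret multiple_unicast G 3 s t by fact
  have flow: "max_flow G (s 1) (t 1) = 1" "max_flow G (s 2) (t 2) = 3" "max_flow G (s 3) (t 3) = 3"
    using assms(2) by (simp_all add: connectivity_level_def upt_rec numeral_eq_Suc)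
  have "\<exists>y. scalar_code G (s 1) (s (k + 2)) y \<and>
      (\<exists>l \<in> in_arcs G (t 1). \<forall>X a b. y X a b l = X mod 2) \<and>
      (\<forall>X a b X' a' b'. (\<forall>e \<in> in_arcs G (t (k + 2)). y X a b e = y X' a' b' e) \<longrightarrow>
        a mod 2 = a' mod 2 \<and> b mod 2 = b' mod 2)" (is "\<exists>y. ?good k y") if k: "k \<in> {..<2}" for k
  proof -
    have i: "1 \<in> {1..3 :: nat}" "k + 2 \<in> {1..3}" using k by auto
    have "k = 0 \<or> k = 1" using k by auto
    then have flow_k: "max_flow G (s (k + 2)) (t (k + 2)) \<ge> 3"
      using flow by (auto simp: numeral_2_eq_2 numeral_3_eq_3)
    show ?thesis
    proof (rule two_session_code)
      show "max_flow G (s 1) (t 1) \<ge> 1" using flow(1) by simp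
      fix y assume "scalar_code G (s 1) (s (k + 2)) y"
        and "\<exists>l \<in> in_arcs G (t 1). \<forall>X a b. y X a b l = X mod 2"
        and "\<And>X a b X' a' b'. \<forall>e \<in> in_arcs G (t (k + 2)). y X a b e = y X' a' b' e \<Longrightarrow>
          a mod 2 = a' mod 2 \<and> b mod 2 = b' mod 2"
      then show ?thesis by (intro exI[of _ y] conjI allI impI) auto
    qed (rule i source_in_verts source_no_in_arcs terminal_no_out_arcs flow_k)+
  qed
  then have "\<forall>k\<in>{..<2}. \<exists>y. ?good k y" by (rule ballI)
  from bchoice[OF this] obtain y where y: "\<forall>k\<in>{..<2}. ?good k (y k)" ..
  have code: "scalar_code G (s 1) (s (k + 2)) (y k)" if "k < 2" for k
    using bspec[OF y, of k] that by simp
  have dec1: "\<exists>l \<in> in_arcs G (t 1). \<forall>X a b. y k X a b l = X mod 2" if "k < 2" for k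
    using bspec[OF y, of k] that by simp
  have dec2: "a mod 2 = a' mod 2 \<and> b mod 2 = b' mod 2"
    if "k < 2" "\<forall>e \<in> in_arcs G (t (k + 2)). y k X a b e = y k X' a' b' e" for k X a b X' a' b'
    using bspec[OF y, of k] that by blast
  let ?y = "\<lambda>x e. \<lambda>k\<in>{..<2}. y k (x 1 k) (x (k + 2) 0) (x (k + 2) 1) e"
  have "recovers_messages F2 2 G 3 t ?y"
  proof (rule recovers_messagesI)
    fix i x x'
    assume i: "i \<in> {1..3}" and x: "x \<in> messages F2 2 3" "x' \<in> messages F2 2 3"
      and eq: "\<And>e. e \<in> in_arcs G (t i) \<Longrightarrow> ?y x e = ?y x' e"
    have eq: "y k (x 1 k) (x (k + 2) 0) (x (k + 2) 1) e = y k (x' 1 k) (x' (k + 2) 0) (x' (k + 2) 1) e"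
      if "e \<in> in_arcs G (t i)" "k < 2" for e k
      using fun_cong[OF eq[OF that(1)], of k] that(2) by simp
    show "x i = x' i"
    proof (rule message_F2_cong[OF x i])
      consider "i = 1" | k where "k < 2" "i = k + 2"
        using i that(2)[of "i - 2"] that(1) by (cases "i = 1") auto
      then have "x i 0 mod 2 = x' i 0 mod 2 \<and> x i 1 mod 2 = x' i 1 mod 2"
      proof cases
        case 1
        \<comment> \<open>Session 1 reads one symbol from each slot; the other two sessions read
          both symbols from a single slot.\<close>
        have "x 1 k mod 2 = x' 1 k mod 2" if "k < 2" for k
          using dec1[OF that] eq[OF _ that] 1 by metis
        then show ?thesis using 1 by simp
      next
        case (2 k)
        then show ?thesis using dec2[OF 2(1)] eq[OF _ 2(1)] by blast
      qed
      then show "x i 0 mod 2 = x' i 0 mod 2" "x i 1 mod 2 = x' i 1 mod 2" by auto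
    qed
  qed
  moreover have "linear_network_code F2 2 G 3 s ?y"
    using fin_digraph_axioms code by (rule interleaved_linear_network_code)
  moreover have "finite (carrier F2)" by simp
  ultimately show ?thesis
    unfolding feasible_def using field_F2 by (intro exI[of _ F2] exI[of _ "2 :: nat"] exI[of _ ?y]) simp
qed

end
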